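(* Fix any $n\in\mathbb{N}$, $n\ge1$, and let $\mathcal{D}=[0,1]^n$ be the unit hypercube in $\mathbb{R}^n$. Let $L_0(\mathcal{D})\subset C^1(\mathcal{D})$ be dense in the $C^{0,1}$ topology. Let $g\in L(\mathcal{D})$, let $\mathbf{x}=\{x_1,\dots,x_N\}$ be sampled i.i.d. uniformly from $\mathcal{D}$, and let $\mathbb{D}_N^{\overline\varepsilon}(g)=\{(x_1,y_1),\dots,(x_N,y_N)\}$ be the resulting noisy dataset obtained from $g$, with noise bound $\overline\varepsilon\ge0$. For a tolerance $\varepsilon$, consider the problem $$\underset{f\in L(\mathcal{D})}{\text{minimize}}\ \ \mathrm{Lip}(f)\quad\text{subject to}\quad \ell(\mathbb{D}_N^{\overline\varepsilon}(g),f)\le\varepsilon, \qquad (P)$$ and let $f^*$ be any solution of $(P)$. Then there exist constants $k_1>0$, $k_2>0$ and $N_0\in\mathbb{N}$, whose values depend only on the dimension $n$, such that for any $\delta\in(0,1)$, $\rho>0$, $\varepsilon>\overline\varepsilon$, and all $N\ge N_0$: (i) there exists a feasible solution $\underline f\in L_0(\mathcal{D})$ of $(P)$ (i.e. $\ell(\mathbb{D}_N^{\overline\varepsilon}(g),\underline f)\le\varepsilon$) that satisfies $l_{\underline f}\le l_{f^*}+\rho$; and (ii) for any such $\underline f$, $$\mathbb{P}\left[\mathcal{L}(\underline f,g)\le(2l_g+\rho)\,k_1\left(\frac{\log(k_2N/\delta)}{N}\right)^{1/n}+2\varepsilon\right]\ge1-\delta .$$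
   Context: $\|\cdot\|$ denotes the Euclidean norm (absolute value on $\mathbb{R}$). For a compact set $\mathcal{D}\subset\mathbb{R}^n$ and a continuous $f:\mathcal{D}\to\mathbb{R}$, the Lipschitz semi-norm is $\mathrm{Lip}(f)=\inf\{\gamma\in[0,\infty]: \|f(x)-f(x')\|\le\gamma\|x-x'\|\ \forall x,x'\in\mathcal{D}\}$, and $L(\mathcal{D})$ is the set of $f:\mathcal{D}\to\mathbb{R}$ with $\mathrm{Lip}(f)<\infty$. We write $l_f:=\mathrm{Lip}(f)$. $C^1(\mathcal{D})$ is the set of continuously differentiable (hence, $\mathcal{D}$ being compact, Lipschitz) functions on $\mathcal{D}$. A subset $L_0(\mathcal{D})\subset C^1(\mathcal{D})$ is dense in the $C^{0,1}$ topology if it is dense (in $C^1(\mathcal{D})$) with respect to the metric induced by the norm $\|f\|_\infty+\|f'\|_\infty$, where $f'$ is the Jacobian of $f$ and sup norms are over $\mathcal{D}$; that is, for every $\varphi\in C^1(\mathcal{D})$ and $\eta>0$ there is $f\in L_0(\mathcal{D})$ with $\|f-\varphi\|_\infty+\|f'-\varphi'\|_\infty\le\eta$. Given $g:\mathcal{D}\to\mathbb{R}$ and $\overline\varepsilon\ge0$, a noisy dataset generated by $g$ with noise bound $\overline\varepsilon$ is a finite set $\mathbb{D}_N^{\overline\varepsilon}(g)=\{(x_1,y_1),\dots,(x_N,y_N)\}\subset\mathcal{D}\times\mathbb{R}$ with $\|g(x_i)-y_i\|\le\overline\varepsilon$ for all $i=1,\dots,N$. The training loss is $\ell(\mathbb{D}_N^{\overline\varepsilon}(g),f)=\max_{1\le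 i\le N}\|y_i-f(x_i)\|$. The loss is $\mathcal{L}(f,g)=\max_{x\in\mathcal{D}}\|g(x)-f(x)\|$. The probability $\mathbb{P}$ is over the random sample $\mathbf{x}$; $f^*$ and $\underline f$ may depend on the sample. *)

theory Defs
  imports "HOL-Probability.Probability"
begin

text \<open>Functions \<open>\<D> \<rightarrow> \<real>\<close> are represented by total functions; every notion below depends
  only on the values taken on \<open>\<D>\<close>.\<close>

definition unit_cube :: "(real^'n) set" where
  "unit_cube = cbox 0 1"

lemma mem_unit_cube_iff: "x \<in> unit_cube \<longleftrightarrow> (\<forall>i. 0 \<le> x $ i \<and> x $ i \<le> 1)"
  by (simp add: unit_cube_def mem_box_cart)

definition Lip :: "'a::euclidean_space set \<Rightarrow> ('a \<Rightarrow> real) \<Rightarrow> ennreal" where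
  "Lip D f = Inf {\<gamma>. \<forall>x\<in>D. \<forall>x'\<in>D. ennreal \<bar>f x - f x'\<bar> \<le> \<gamma> * ennreal (norm (x - x'))}"

definition lipschitz_functions :: "'a::euclidean_space set \<Rightarrow> ('a \<Rightarrow> real) set" where
  "lipschitz_functions D = {f. Lip D f < \<infinity>}"

text \<open>The Jacobian (a row vector) relative to \<open>\<D>\<close>, so one-sided at the boundary. The derivative
  within \<open>\<D>\<close> is unique when \<open>\<D>\<close> is a nondegenerate box.\<close>

definition gradient_on :: "(real^'n) set \<Rightarrow> (real^'n \<Rightarrow> real) \<Rightarrow> real^'n \<Rightarrow> real^'n" where
  "gradient_on D f x = (\<chi> i. frechet_derivative f (at x within D) (axis i 1))"

definition C1_functions :: "(real^'n) set \<Rightarrow> (real^'n \<Rightarrow> real) set" where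
  "C1_functions D = {f. f differentiable_on D \<and> continuous_on D (gradient_on D f)}"

definition sup_norm :: "'a set \<Rightarrow> ('a \<Rightarrow> 'b::real_normed_vector) \<Rightarrow> real" where
  "sup_norm D f = (SUP x\<in>D. norm (f x))"

definition C01_dense :: "(real^'n) set \<Rightarrow> (real^'n \<Rightarrow> real) set \<Rightarrow> bool" where
  "C01_dense D L0 \<longleftrightarrow> L0 \<subseteq> C1_functions D \<and>
     (\<forall>\<phi>\<in>C1_functions D. \<forall>\<eta>>0. \<exists>f\<in>L0.
        sup_norm D (\<lambda>x. f x - \<phi> x)
        + sup_norm D (\<lambda>x. gradient_on D f x - gradient_on D \<phi> x) \<le> \<eta>)"

definition dataset :: "nat \<Rightarrow> (nat \<Rightarrow> 'a) \<Rightarrow> (nat \<Rightarrow> real) \<Rightarrow> ('a \<times> real) set" where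
  "dataset N x y = (\<lambda>i. (x i, y i)) ` {1..N}"

definition noisy_dataset :: "'a set \<Rightarrow> ('a \<Rightarrow> real) \<Rightarrow> real \<Rightarrow> ('a \<times> real) set \<Rightarrow> bool" where
  "noisy_dataset D g \<epsilon> S \<longleftrightarrow>
     finite S \<and> S \<subseteq> D \<times> UNIV \<and> (\<forall>(x, y)\<in>S. \<bar>g x - y\<bar> \<le> \<epsilon>)"

definition training_loss :: "('a \<times> real) set \<Rightarrow> ('a \<Rightarrow> real) \<Rightarrow> real" where
  "training_loss S f = Max ((\<lambda>(x, y). \<bar>y - f x\<bar>) ` S)"

text \<open>The maximum over \<open>\<D>\<close>, written as a supremum; it is attained for continuous functions
  on a nonempty compact \<open>\<D>\<close>.\<close>

definition loss :: "'a set \<Rightarrow> ('a \<Rightarrow> real) \<Rightarrow> ('a \<Rightarrow> real) \<Rightarrow> real" where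
  "loss D f g = (SUP x\<in>D. \<bar>g x - f x\<bar>)"

definition feasible ::
    "'a::euclidean_space set \<Rightarrow> ('a \<times> real) set \<Rightarrow> real \<Rightarrow> ('a \<Rightarrow> real) \<Rightarrow> bool" where
  "feasible D S \<epsilon> f \<longleftrightarrow> f \<in> lipschitz_functions D \<and> training_loss S f \<le> \<epsilon>"

definition solution ::
    "'a::euclidean_space set \<Rightarrow> ('a \<times> real) set \<Rightarrow> real \<Rightarrow> ('a \<Rightarrow> real) \<Rightarrow> bool" where
  "solution D S \<epsilon> f \<longleftrightarrow> feasible D S \<epsilon> f \<and> (\<forall>h. feasible D S \<epsilon> h \<longrightarrow> Lip D f \<le> Lip D h)"

definition sample_measure :: "nat \<Rightarrow> (nat \<Rightarrow> real^'n) measure" where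
  "sample_measure N = PiM {1..N} (\<lambda>_. uniform_measure lborel unit_cube)"

text \<open>A function chosen depending on the sample need not depend on it measurably, so the
  probability of an event about it is the inner probability, which is the ordinary one
  whenever the event is measurable.\<close>

definition inner_prob :: "'a measure \<Rightarrow> 'a set \<Rightarrow> real" where
  "inner_prob M S = (SUP E\<in>{E \<in> sets M. E \<subseteq> S}. measure M E)"

lemma inner_prob_eq_measure:
  assumes "finite_measure M" "S \<in> sets M"
  shows "inner_prob M S = measure M S"
  unfolding inner_prob_def
  by (rule cSup_eq_maximum)
     (use assms in \<open>auto intro: finite_measure.finite_measure_mono\<close>)

end

theory Submission
  imports Defs
begin

text \<open>Existence of a near-optimal \<open>f \<in> L0\<close>: extend a feasible Lipschitz function from the cube to
  the whole space by composing it with the 1-Lipschitz nearest-point projection, mollify, and use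
  density; none of these steps increases the Lipschitz constant by more than an arbitrarily small
  amount. For the error bound, \<open>g\<close> is itself feasible, so
  \<open>Lip f \<le> Lip g + \<rho>\<close>, and comparing \<open>f\<close> and \<open>g\<close> at \<open>z\<close> through a sample point at distance
  at most \<open>r\<close> gives \<open>\<bar>g z - f z\<bar> \<le> (2 Lip g + \<rho>) r + 2 \<epsilon>\<close>. Such a sample point exists for
  every \<open>z\<close> as soon as the sample hits every cell of a grid of diameter at most \<open>r\<close>.\<close>

section \<open>Lipschitz constants and smoothing\<close>

lemma Lip_le_ennreal_iff:
  assumes "0 \<le> \<gamma>"
  shows "Lip D f \<le> ennreal \<gamma> \<longleftrightarrow> \<gamma>-lipschitz_on D f"
proof
  assume L: "Lip D f \<le> ennreal \<gamma>"
  show "\<gamma>-lipschitz_on D f"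
  proof (rule lipschitz_onI[OF _ assms])
    fix x x' assume D: "x \<in> D" "x' \<in> D"
    show "dist (f x) (f x') \<le> \<gamma> * dist x x'"
    proof (cases "x = x'")
      case False
      have "ennreal (\<bar>f x - f x'\<bar> / norm (x - x')) \<le> Lip D f"
        unfolding Lip_def
      proof (rule Inf_greatest)
        fix c assume "c \<in> {\<gamma>. \<forall>x\<in>D. \<forall>x'\<in>D. ennreal \<bar>f x - f x'\<bar> \<le> \<gamma> * ennreal (norm (x - x'))}"
        then have c: "ennreal \<bar>f x - f x'\<bar> \<le> c * ennreal (norm (x - x'))"
          using D by blast
        show "ennreal (\<bar>f x - f x'\<bar> / norm (x - x')) \<le> c"
        proof (cases c)
          case (real r)
          with c have "\<bar>f x - f x'\<bar> \<le> r * norm (x - x')"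
            by (simp flip: ennreal_mult)
          with real False show ?thesis
            by (auto simp: divide_le_eq intro!: ennreal_leI)
        qed auto
      qed
      also note L
      finally show ?thesis
        using False assms by (simp add: dist_norm divide_le_eq)
    qed simp
  qed
next
  assume L: "\<gamma>-lipschitz_on D f"
  show "Lip D f \<le> ennreal \<gamma>"
    unfolding Lip_def
    using assms lipschitz_on_normD[OF L]
    by (intro Inf_lower) (auto simp flip: ennreal_mult)
qed

lemma lipschitz_functions_iff: "f \<in> lipschitz_functions D \<longleftrightarrow> (\<exists>\<gamma>. \<gamma>-lipschitz_on D f)"
proof
  assume "f \<in> lipschitz_functions D"
  then obtain r where "0 \<le> r" "Lip D f = ennreal r"
    by (cases "Lip D f") (auto simp: lipschitz_functions_def)
  then show "\<exists>\<gamma>. \<gamma>-lipschitz_on D f"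
    by (metis Lip_le_ennreal_iff order_refl)
next
  assume "\<exists>\<gamma>. \<gamma>-lipschitz_on D f"
  then obtain \<gamma> where L: "\<gamma>-lipschitz_on D f" ..
  then have "Lip D f \<le> ennreal \<gamma>"
    by (simp add: Lip_le_ennreal_iff lipschitz_on_nonneg)
  then show "f \<in> lipschitz_functions D"
    by (auto simp: lipschitz_functions_def intro: le_less_trans)
qed

lemma lipschitz_on_Lip:
  "f \<in> lipschitz_functions D \<Longrightarrow> (enn2real (Lip D f))-lipschitz_on D f"
  by (subst Lip_le_ennreal_iff[symmetric]) (auto simp: lipschitz_functions_def)

text \<open>Squaring the positive part removes its kink: at 0 the difference quotient is
  \<open>max 0 h\<close>, which tends to 0. This makes the kernel \<open>k\<close> below
  continuously differentiable across the boundary of its support.\<close>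

lemma DERIV_max_0_squared:
  "((\<lambda>t::real. (max 0 t)\<^sup>2) has_real_derivative 2 * max 0 t) (at t)"
proof -
  consider "t > 0" | "t < 0" | "t = 0" by linarith
  then show ?thesis
  proof cases
    case 1
    have "((\<lambda>t. t\<^sup>2) has_real_derivative 2 * max 0 t) (at t)"
      using 1 by (auto intro!: derivative_eq_intros)
    then show ?thesis
      by (rule has_field_derivative_transform_within_open[where S="{0<..}"]) (use 1 in auto)
  next
    case 2
    have "((\<lambda>t. 0) has_real_derivative 2 * max 0 t) (at t)"
      using 2 by (auto intro!: derivative_eq_intros)
    then show ?thesis
      by (rule has_field_derivative_transform_within_open[where S="{..<0}"]) (use 2 in auto)
  next
    case 3
    have "((\<lambda>h::real. max 0 h) \<longlongrightarrow> max 0 0) (at 0)"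
      by (intro tendsto_intros)
    then have "((\<lambda>h::real. max 0 h) \<longlongrightarrow> 0) (at 0)" by simp
    then have "((\<lambda>h::real. (max 0 h)\<^sup>2 / h) \<longlongrightarrow> 0) (at 0)"
      by (rule Lim_transform_eventually)
         (auto simp: eventually_at_filter max_def power2_eq_square)
    then show ?thesis
      using 3 by (simp add: DERIV_def)
  qed
qed

text \<open>Convolution with a compactly supported C^1 kernel. The result averages translates of
  \<open>f\<close>, each of them \<open>L\<close>-Lipschitz, so the constant \<open>L\<close> is
  kept exactly. The derivative is given as a continuous family of bounded linear maps, so that
  differentiation under the integral yields its continuity as well.\<close>

lemma C1_approximation:
  fixes f :: "'a::euclidean_space \<Rightarrow> real"
  assumes f: "L-lipschitz_on UNIV f" and S: "compact S" "convex S" and e: "e > 0"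
  obtains \<phi> \<phi>' where "continuous_on S \<phi>'"
    "\<And>x. x \<in> S \<Longrightarrow> (\<phi> has_derivative blinfun_apply (\<phi>' x)) (at x within S)"
    "L-lipschitz_on S \<phi>" "\<And>x. \<bar>\<phi> x - f x\<bar> \<le> e"
proof -
  have L: "L \<ge> 0" using f by (rule lipschitz_on_nonneg)
  \<comment> \<open>Shifts of length at most \<open>r\<close> change \<open>f\<close> by at most
    \<open>e\<close>; the \<open>+ 1\<close> covers \<open>L = 0\<close>.\<close>
  define r where "r = e / (L + 1)"
  have r: "r > 0" "L * r \<le> e"
    using e L by (auto simp: r_def field_simps)
  \<comment> \<open>An unnormalised polynomial bump supported in \<open>cball 0 r\<close>;
    \<open>dk\<close> is its derivative. Normalisation is the division by \<open>c\<close>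
    below.\<close>
  define k :: "'a \<Rightarrow> real" where "k z = (max 0 (r\<^sup>2 - z \<bullet> z))\<^sup>2" for z
  define dk :: "'a \<Rightarrow> 'a \<Rightarrow>\<^sub>L real"
    where "dk z = (- 4 * max 0 (r\<^sup>2 - z \<bullet> z)) *\<^sub>R blinfun_inner_right z" for z
  have k_nonneg: "0 \<le> k z" for z by (simp add: k_def)
  have k_zero: "k z = 0" if "r < norm z" for z
  proof -
    have "r\<^sup>2 \<le> (norm z)\<^sup>2" using that r by (intro power_mono) auto
    then show ?thesis by (simp add: k_def power2_norm_eq_inner)
  qed
  have k_cont [continuous_intros]: "continuous_on A (\<lambda>x. k (h x))" if "continuous_on A h"
    for A :: "'c::topological_space set" and h
    unfolding k_def by (intro continuous_intros that)
  have dk_cont [continuous_intros]: "continuous_on A (\<lambda>x. dk (h x))" if "continuous_on A h"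
    for A :: "'c::topological_space set" and h
    unfolding dk_def
    by (intro continuous_intros that bounded_linear.continuous_on[OF bounded_linear_blinfun_inner_right])
  have dk: "(k has_derivative blinfun_apply (dk z)) (at z within A)" for z A
  proof -
    have "((\<lambda>z::'a. r\<^sup>2 - z \<bullet> z) has_derivative (\<lambda>v. - 2 * (z \<bullet> v))) (at z within A)"
      by (auto intro!: derivative_eq_intros simp: inner_commute)
    from DERIV_compose_FDERIV[OF DERIV_max_0_squared this] show ?thesis
      unfolding k_def dk_def by (rule has_derivative_eq_rhs)
        (auto simp: blinfun.scaleR_left blinfun.minus_left fun_eq_iff)
  qed
  have f_cont: "continuous_on A f" for A
    by (rule continuous_on_subset[OF lipschitz_on_continuous_on[OF f]]) simp
  have f_cont' [continuous_intros]: "continuous_on A (\<lambda>x. f (h x))" if "continuous_on A h"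
    for A :: "'c::topological_space set" and h
    using continuous_on_compose2[OF f_cont that] by auto
  have int: "integrable lborel (\<lambda>t. u t * k t)" if "continuous_on UNIV u" for u :: "'a \<Rightarrow> real"
  proof -
    have "integrable lborel (\<lambda>t. indicator (cball 0 r) t *\<^sub>R (u t * k t))"
      by (intro borel_integrable_compact continuous_intros continuous_on_subset[OF that]) auto
    also have "(\<lambda>t. indicator (cball 0 r) t *\<^sub>R (u t * k t)) = (\<lambda>t. u t * k t)"
      using k_zero by (force simp: indicator_def)
    finally show ?thesis .
  qed
  define c where "c = (\<integral>t. k t \<partial>lborel)"
  have int_k: "integrable lborel k" using int[of "\<lambda>_. 1"] by simp
  \<comment> \<open>A continuous nonnegative function with zero integral over a box with nonempty
    interior vanishes on it, but \<open>k 0\<close> is the fourth power of \<open>r\<close>.\<close>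
  have c: "c > 0"
  proof -
    obtain a where a: "ball 0 r \<subseteq> cbox (-a) (a::'a)"
      using bounded_subset_cbox_symmetric[of "ball 0 r"] by auto
    have ne: "box (-a) a \<noteq> {}"
    proof -
      have "0 \<in> interior (cbox (-a) a)"
        by (rule interiorI[OF _ _ a]) (use r in auto)
      then show ?thesis by auto
    qed
    have 0: "0 \<in> cbox (-a) a" using a r by (auto simp: subset_iff)
    have "integral (cbox (-a) a) k \<noteq> 0"
      using 0 r by (subst integral_cbox_eq_0_iff)
        (auto intro!: continuous_intros ne k_nonneg bexI[of _ 0] simp: k_def)
    moreover have "set_integrable lborel (cbox (-a) a) k"
      unfolding set_integrable_def by (intro borel_integrable_compact continuous_intros) auto
    ultimately have "0 \<noteq> (LINT x:cbox (-a) a|lborel. k x)"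
      using set_borel_integral_eq_integral(2) by metis
    moreover have "0 \<le> (LINT x:cbox (-a) a|lborel. k x)"
      unfolding set_lebesgue_integral_def by (intro Bochner_Integration.integral_nonneg) (simp add: k_nonneg)
    moreover have "(LINT x:cbox (-a) a|lborel. k x) \<le> c"
      unfolding set_lebesgue_integral_def c_def
      using \<open>set_integrable lborel (cbox (-a) a) k\<close>
      by (intro integral_mono int_k) (auto simp: k_nonneg indicator_def set_integrable_def)
    ultimately show ?thesis by linarith
  qed
  \<comment> \<open>Since \<open>k / c\<close> is a probability density supported in
    \<open>cball 0 r\<close>, the average of \<open>u\<close> inherits any bound on
    \<open>\<bar>u\<bar>\<close> over that ball. Both the approximation error and the Lipschitz
    constant follow from this.\<close>
  have bound: "\<bar>(\<integral>t. u t * k t \<partial>lborel) / c\<bar> \<le> B"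
    if u: "continuous_on UNIV u" and B: "\<And>t. norm t \<le> r \<Longrightarrow> \<bar>u t\<bar> \<le> B" for u :: "'a \<Rightarrow> real" and B
  proof -
    have "\<bar>\<integral>t. u t * k t \<partial>lborel\<bar> \<le> (\<integral>t. B * k t \<partial>lborel)"
    proof (rule integral_abs_bound_integral)
      fix t show "\<bar>u t * k t\<bar> \<le> B * k t"
        using B[of t] k_zero[of t] k_nonneg[of t]
        by (cases "norm t \<le> r") (auto simp: abs_mult intro: mult_right_mono)
    qed (use int_k int[OF u] in auto)
    then show ?thesis using c by (simp add: c_def divide_le_eq)
  qed
  define \<phi> where "\<phi> x = (\<integral>t. f (x + t) * k t \<partial>lborel) / c" for x
  have approx: "\<bar>\<phi> x - f x\<bar> \<le> e" for x
  proof -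
    have "\<phi> x - f x = (\<integral>t. f (x + t) * k t \<partial>lborel) / c - (\<integral>t. f x * k t \<partial>lborel) / c"
      using c by (simp add: \<phi>_def c_def)
    also have "\<dots> = (\<integral>t. (f (x + t) - f x) * k t \<partial>lborel) / c"
      unfolding left_diff_distrib
      by (subst Bochner_Integration.integral_diff)
         (auto intro!: int int_k continuous_intros simp: diff_divide_distrib)
    also have "\<bar>\<dots>\<bar> \<le> e"
    proof (rule bound)
      fix t :: 'a assume t: "norm t \<le> r"
      have "\<bar>f (x + t) - f x\<bar> \<le> L * norm t"
        using lipschitz_on_normD[OF f, of "x + t" x] by simp
      also have "\<dots> \<le> L * r" using t L by (rule mult_left_mono)
      finally show "\<bar>f (x + t) - f x\<bar> \<le> e" using r by simp
    qed (intro continuous_intros)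
    finally show ?thesis .
  qed
  have lip: "L-lipschitz_on S \<phi>"
  proof (rule lipschitz_onI[OF _ L])
    fix x y
    have "\<phi> x - \<phi> y = (\<integral>t. (f (x + t) - f (y + t)) * k t \<partial>lborel) / c"
      unfolding left_diff_distrib \<phi>_def
      by (subst Bochner_Integration.integral_diff)
         (auto intro!: int continuous_intros simp: diff_divide_distrib)
    also have "\<bar>\<dots>\<bar> \<le> L * dist x y"
    proof (rule bound)
      fix t :: 'a
      show "\<bar>f (x + t) - f (y + t)\<bar> \<le> L * dist x y"
        using lipschitz_on_normD[OF f, of "x + t" "y + t"] by (simp add: dist_norm)
    qed (intro continuous_intros)
    finally show "dist (\<phi> x) (\<phi> y) \<le> L * dist x y" by (simp add: dist_norm)
  qed
  \<comment> \<open>One box contains \<open>S + cball 0 r\<close>, so for all \<open>x\<close> in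
    \<open>S\<close> the integral can be taken over the same compact domain, as the Leibniz rule
    requires.\<close>
  obtain a where a: "(\<lambda>(x, y). x + y) ` (S \<times> cball 0 r) \<subseteq> cbox (-a) a"
  proof -
    have "compact ((\<lambda>(x, y). x + y) ` (S \<times> cball 0 r))"
      unfolding case_prod_unfold
      by (intro compact_continuous_image continuous_intros compact_Times S compact_cball)
    then show thesis
      using bounded_subset_cbox_symmetric compact_imp_bounded that by metis
  qed
  \<comment> \<open>Translation moves the dependence on \<open>x\<close> from \<open>f\<close>,
    which is only Lipschitz, to the differentiable kernel.\<close>
  have repr: "\<phi> x = integral (cbox (-a) a) (\<lambda>t. f t * k (t - x)) / c" if x: "x \<in> S" for x
  proof -
    have si: "set_integrable lborel (cbox (-a) a) (\<lambda>t. f t * k (t - x))"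
      unfolding set_integrable_def
      by (intro borel_integrable_compact continuous_intros) auto
    have "(\<integral>t. f (x + t) * k t \<partial>lborel) = (\<integral>t. f (x + t) * k ((x + t) - x) \<partial>lborel)"
      by simp
    also have "\<dots> = (\<integral>t. f t * k (t - x) \<partial>distr lborel borel ((+) x))"
      by (intro integral_distr[symmetric] borel_measurable_continuous_onI continuous_intros) auto
    also have "\<dots> = (\<integral>t. f t * k (t - x) \<partial>lborel)"
      by (simp add: lborel_distr_plus)
    also have "\<dots> = (LINT t:cbox (-a) a|lborel. f t * k (t - x))"
      unfolding set_lebesgue_integral_def
    proof (intro Bochner_Integration.integral_cong refl)
      fix t
      show "f t * k (t - x) = indicator (cbox (-a) a) t *\<^sub>R (f t * k (t - x))"
      proof (cases "norm (t - x) \<le> r")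
        case True
        then have "t \<in> (\<lambda>(x, y). x + y) ` (S \<times> cball 0 r)"
          using x by (intro image_eqI[of _ _ "(x, t - x)"]) auto
        with a show ?thesis by auto
      qed (simp add: k_zero)
    qed
    also have "\<dots> = integral (cbox (-a) a) (\<lambda>t. f t * k (t - x))"
      by (rule set_borel_integral_eq_integral(2)[OF si])
    finally show ?thesis by (simp add: \<phi>_def)
  qed
  \<comment> \<open>The sign is that of the derivative of \<open>t - x\<close> in
    \<open>x\<close>.\<close>
  define d where "d x t = (- f t) *\<^sub>R dk (t - x)" for x t
  have d_cont: "continuous_on (S \<times> cbox (-a) a) (\<lambda>(x, t). d x t)"
    unfolding d_def case_prod_unfold by (intro continuous_intros)
  define \<phi>' where "\<phi>' x = integral (cbox (-a) a) (d x) /\<^sub>R c" for x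
  have deriv: "(\<phi> has_derivative blinfun_apply (\<phi>' x)) (at x within S)" if x: "x \<in> S" for x
  proof -
    have "((\<lambda>x. integral (cbox (-a) a) (\<lambda>t. f t * k (t - x))) has_derivative
       integral (cbox (-a) a) (d x)) (at x within S)"
    proof (rule leibniz_rule[OF _ _ d_cont x S(2)])
      fix x t
      have "((\<lambda>x. k (t - x)) has_derivative (\<lambda>v. dk (t - x) (- v))) (at x within S)"
        by (rule has_derivative_compose[OF _ dk]) (auto intro!: derivative_eq_intros)
      then show "((\<lambda>x. f t * k (t - x)) has_derivative blinfun_apply (d x t)) (at x within S)"
        by (rule has_derivative_eq_rhs[OF has_derivative_mult_right])
           (auto simp: d_def blinfun.scaleR_left blinfun.minus_right blinfun.minus_left)
    next
      show "(\<lambda>t. f t * k (t - x)) integrable_on cbox (-a) a" for x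
        by (intro integrable_continuous continuous_intros)
    qed
    then have "((\<lambda>x. integral (cbox (-a) a) (\<lambda>t. f t * k (t - x)) /\<^sub>R c) has_derivative
       blinfun_apply (\<phi>' x)) (at x within S)"
      by (rule has_derivative_eq_rhs[OF has_derivative_scaleR_right])
         (simp add: \<phi>'_def blinfun.scaleR_left fun_eq_iff)
    then show ?thesis
      by (rule has_derivative_transform[OF x, rotated])
         (simp add: repr divide_inverse mult.commute)
  qed
  have "continuous_on S \<phi>'"
    unfolding \<phi>'_def by (intro continuous_intros integral_continuous_on_param d_cont)
  from that[OF this deriv lip approx] show thesis .
qed

section \<open>Density of the random sample\<close>

text \<open>Closed cells share faces. The overlap is harmless, because the argument uses only that
  the cells cover the cube and the size of each one.\<close>

definition grid_cell :: "nat \<Rightarrow> ('n \<Rightarrow> nat) \<Rightarrow> (real^'n) set" where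
  "grid_cell m j = cbox (\<chi> i. real (j i) / real m) (\<chi> i. (real (j i) + 1) / real m)"

lemma mem_grid_cell:
  "x \<in> grid_cell m j \<longleftrightarrow> (\<forall>i. real (j i) / real m \<le> x $ i \<and> x $ i \<le> (real (j i) + 1) / real m)"
  by (simp add: grid_cell_def mem_box_cart)

lemma grid_cell_subset:
  assumes "m > 0" "j \<in> UNIV \<rightarrow> {..<m}"
  shows "grid_cell m j \<subseteq> unit_cube"
proof
  fix x assume x: "x \<in> grid_cell m j"
  show "x \<in> unit_cube"
    unfolding mem_unit_cube_iff
  proof
    fix i
    have "j i < m" using assms(2) by (simp add: Pi_iff)
    then have "real (j i) + 1 \<le> real m" by linarith
    then have "(real (j i) + 1) / real m \<le> 1" using assms(1) by simp
    moreover have "0 \<le> real (j i) / real m" by simp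
    ultimately show "0 \<le> x $ i \<and> x $ i \<le> 1"
      using x unfolding mem_grid_cell by (meson order_trans)
  qed
qed

lemma grid_cell_cover:
  fixes x :: "real^'n"
  assumes "m > 0" "x \<in> unit_cube"
  obtains j where "j \<in> UNIV \<rightarrow> {..<m}" "x \<in> grid_cell m j"
proof -
  have "\<exists>k<m. real k / real m \<le> x $ i \<and> x $ i \<le> (real k + 1) / real m" for i
  \<comment> \<open>For the coordinate 1 the floor of \<open>x $ i * m\<close> would be the
    out-of-range index \<open>m\<close>; such a point belongs to the last cell,
    \<open>m - 1\<close>.\<close>
  proof (cases "x $ i = 1")
    case True
    then show ?thesis using assms(1) by (intro exI[of _ "m - 1"]) (auto simp: of_nat_diff)
  next
    case False
    then have x: "0 \<le> x $ i" "x $ i < 1"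
      using assms(2) unfolding mem_unit_cube_iff by (auto simp: less_le)
    define k where "k = nat \<lfloor>x $ i * real m\<rfloor>"
    have k: "real k \<le> x $ i * real m" "x $ i * real m \<le> real k + 1"
      using x unfolding k_def by (simp, linarith)
    have "real k < real m"
      using k(1) x(2) assms(1) by (smt (verit) mult_less_cancel_right2 of_nat_0_less_iff)
    then show ?thesis
      using k assms(1) by (intro exI[of _ k]) (auto simp: field_simps)
  qed
  then obtain j where "\<And>i. j i < m \<and> real (j i) / real m \<le> x $ i \<and> x $ i \<le> (real (j i) + 1) / real m"
    by metis
  then show thesis by (intro that[of j]) (auto simp: mem_grid_cell)
qed

lemma norm_le_sqrt_CARD:
  fixes x :: "real^'n"
  assumes "\<And>i. \<bar>x $ i\<bar> \<le> b"
  shows "norm x \<le> sqrt (real CARD('n)) * b"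
proof -
  have b: "0 \<le> b" using assms[of undefined] by linarith
  have "norm x \<le> norm (\<chi> i. b :: real^'n)"
    using assms b by (intro norm_le_componentwise_cart) auto
  also have "\<dots> = sqrt (real CARD('n)) * b"
    using b by (simp add: norm_vec_def L2_set_def real_sqrt_mult)
  finally show ?thesis .
qed

lemma grid_cell_diameter:
  fixes x y :: "real^'n"
  assumes "x \<in> grid_cell m j" "y \<in> grid_cell m j"
  shows "norm (x - y) \<le> sqrt (real CARD('n)) / real m"
proof -
  have "norm (x - y) \<le> sqrt (real CARD('n)) * (1 / real m)"
  proof (rule norm_le_sqrt_CARD)
    fix i
    have "(real (j i) + 1) / real m - real (j i) / real m = 1 / real m"
      by (simp add: add_divide_distrib)
    then show "\<bar>(x - y) $ i\<bar> \<le> 1 / real m"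
      using assms[unfolded mem_grid_cell] by (smt (verit) vector_minus_component)
  qed
  then show ?thesis by simp
qed

lemma measure_grid_cell:
  assumes "m > 0"
  shows "measure lborel (grid_cell m j :: (real^'n) set) = (1 / real m) ^ CARD('n)"
proof -
  have "real (j i) / real m \<le> (real (j i) + 1) / real m" for i
    by (simp add: divide_right_mono)
  then have "grid_cell m j \<noteq> ({} :: (real^'n) set)"
    by (simp add: grid_cell_def interval_ne_empty_cart)
  then show ?thesis
    by (simp add: grid_cell_def content_cbox_cart flip: diff_divide_distrib)
qed

section \<open>Uniform sampling from the cube\<close>

lemma unit_cube_nonempty: "unit_cube \<noteq> ({} :: (real^'n) set)"
proof -
  have "(0 :: real^'n) \<in> unit_cube" by (simp add: mem_unit_cube_iff)
  then show ?thesis by blast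
qed

lemma unit_cube_measure: "measure lborel (unit_cube :: (real^'n) set) = 1"
    "emeasure lborel (unit_cube :: (real^'n) set) = 1"
proof -
  show 1: "measure lborel (unit_cube :: (real^'n) set) = 1"
    using unit_cube_nonempty[where 'n='n] by (simp add: unit_cube_def content_cbox_cart)
  show "emeasure lborel (unit_cube :: (real^'n) set) = 1"
    using 1 emeasure_lborel_cbox_finite[of 0 "1 :: real^'n"]
    by (simp add: emeasure_eq_ennreal_measure unit_cube_def)
qed

lemma unit_cube_prob_space:
  "prob_space (uniform_measure lborel (unit_cube :: (real^'n) set))"
  by (rule prob_space_uniform_measure) (simp_all add: unit_cube_measure)

lemma sets_unit_cube [measurable]: "unit_cube \<in> sets borel"
  and sets_grid_cell [measurable]: "grid_cell m j \<in> sets borel"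
  by (simp_all add: unit_cube_def grid_cell_def)

text \<open>A measurable event inside \<open>S\<close> suffices for a lower bound, so nothing has to
  be shown about how measurably the chosen function depends on the sample.\<close>

lemma inner_prob_ge:
  assumes "prob_space M" "E \<in> sets M" "E \<subseteq> S" "p \<le> measure M E"
  shows "p \<le> inner_prob M S"
proof -
  interpret prob_space M by fact
  have "measure M E \<le> inner_prob M S"
    unfolding inner_prob_def
    using assms by (intro cSUP_upper bdd_aboveI2[of _ _ 1]) auto
  with assms(4) show ?thesis by linarith
qed

text \<open>\<open>uniform_measure\<close> keeps the whole space as its underlying set, so samples
  with all points in the cube form only an almost sure event.\<close>

lemma sample_in_cube:
  "({1..N} \<rightarrow>\<^sub>E unit_cube) \<in> sets (sample_measure N :: (nat \<Rightarrow> real^'n) measure)"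
  "measure (sample_measure N :: (nat \<Rightarrow> real^'n) measure) ({1..N} \<rightarrow>\<^sub>E unit_cube) = 1"
proof -
  define U where "U = uniform_measure lborel (unit_cube :: (real^'n) set)"
  interpret U: prob_space U
    unfolding U_def by (rule unit_cube_prob_space)
  interpret P: finite_product_prob_space "\<lambda>_. U" "{1..N}"
    by standard auto
  show "({1..N} \<rightarrow>\<^sub>E unit_cube) \<in> sets (sample_measure N :: (nat \<Rightarrow> real^'n) measure)"
    unfolding sample_measure_def by (intro sets_PiM_I_finite) auto
  show "measure (sample_measure N :: (nat \<Rightarrow> real^'n) measure) ({1..N} \<rightarrow>\<^sub>E unit_cube) = 1"
    unfolding sample_measure_def U_def[symmetric]
    by (subst P.prob_times) (simp_all add: U_def unit_cube_measure)
qed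

text \<open>Union bound over the \<open>m ^ CARD('n)\<close> cells of the grid, each of which is missed by a
  single sample point with probability \<open>1 - 1 / m ^ CARD('n)\<close>.\<close>

lemma sample_hits_all_cells:
  fixes m N :: nat
  defines "J \<equiv> (UNIV :: 'n::finite set) \<rightarrow>\<^sub>E {..<m}"
  assumes m: "m > 0"
  obtains E where "E \<in> sets (sample_measure N :: (nat \<Rightarrow> real^'n) measure)"
    "E \<subseteq> {1..N} \<rightarrow>\<^sub>E unit_cube"
    "\<And>x j. x \<in> E \<Longrightarrow> j \<in> J \<Longrightarrow> \<exists>i\<in>{1..N}. x i \<in> grid_cell m j"
    "1 - real m ^ CARD('n) * exp (- real N / real m ^ CARD('n)) \<le> measure (sample_measure N) E"
proof -
  define U where "U = uniform_measure lborel (unit_cube :: (real^'n) set)"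
  interpret U: prob_space U
    unfolding U_def by (rule unit_cube_prob_space)
  interpret P: finite_product_prob_space "\<lambda>_. U" "{1..N}"
    by standard auto
  have S: "sample_measure N = Pi\<^sub>M {1..N} (\<lambda>_. U)"
    by (simp add: sample_measure_def U_def)
  have U_sets [measurable_cong]: "sets U = sets borel" by (simp add: U_def)
  have U_meas: "measure U A = measure lborel (unit_cube \<inter> A)" if "A \<in> sets borel" for A
    using that by (simp add: U_def unit_cube_measure)
  define q where "q = 1 / real m ^ CARD('n)"
  have J: "finite J" "card J = m ^ CARD('n)"
    by (simp_all add: J_def finite_PiE card_PiE)
  define Q where "Q = (\<Pi>\<^sub>E i\<in>{1..N}. unit_cube :: (real^'n) set)"
  \<comment> \<open>The event that all sample points miss cell \<open>j\<close>. By independence its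
    probability is \<open>(1 - q) ^ N\<close>, which \<open>1 - q \<le> exp (- q)\<close> turns into
    an exponential bound.\<close>
  define R where "R j = (\<Pi>\<^sub>E i\<in>{1..N}. (unit_cube - grid_cell m j :: (real^'n) set))" for j
  have meas: "Q \<in> sets (Pi\<^sub>M {1..N} (\<lambda>_. U))" "R j \<in> sets (Pi\<^sub>M {1..N} (\<lambda>_. U))" for j
    unfolding Q_def R_def by (intro sets_PiM_I_finite; simp add: U_sets)+
  have Q: "P.prob Q = 1"
    using sample_in_cube(2)[where 'n='n, of N] by (simp only: Q_def S)
  have R: "P.prob (R j) \<le> exp (- real N / real m ^ CARD('n))" if j: "j \<in> J" for j
  proof -
    have sub: "grid_cell m j \<subseteq> unit_cube"
      using j by (intro grid_cell_subset[OF m]) (auto simp: J_def)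
    have "measure U (unit_cube - grid_cell m j) = measure lborel (unit_cube - grid_cell m j)"
      by (subst U_meas) (auto intro!: arg_cong[of _ _ "measure lborel"])
    also have "\<dots> = 1 - q"
      using sub by (subst measure_Diff)
        (auto simp: unit_cube_measure measure_grid_cell[OF m] q_def power_divide)
    finally have "P.prob (R j) = (1 - q) ^ N"
      unfolding R_def by (subst P.prob_times) (simp_all add: U_sets)
    also have "\<dots> \<le> exp (- q) ^ N"
      using m by (intro power_mono) (use exp_ge_add_one_self[of "-q"] in \<open>auto simp: q_def\<close>)
    also have "\<dots> = exp (- real N / real m ^ CARD('n))"
      by (simp add: q_def flip: exp_of_nat_mult)
    finally show ?thesis .
  qed
  have un: "(\<Union>j\<in>J. R j) \<in> P.events"
    using J meas by blast
  show thesis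
  proof (rule that[of "Q - (\<Union>j\<in>J. R j)"])
    show "Q - (\<Union>j\<in>J. R j) \<in> sets (sample_measure N)"
      using meas un unfolding S by blast
    show "Q - (\<Union>j\<in>J. R j) \<subseteq> {1..N} \<rightarrow>\<^sub>E unit_cube"
      by (auto simp: Q_def)
    show "\<exists>i\<in>{1..N}. x i \<in> grid_cell m j" if "x \<in> Q - (\<Union>j\<in>J. R j)" "j \<in> J" for x j
    proof (rule ccontr)
      assume "\<not> ?thesis"
      with that have "x \<in> R j" by (auto simp: Q_def R_def PiE_iff)
      with that show False by auto
    qed
    have "P.prob (Q - (\<Union>j\<in>J. R j)) = P.prob Q - P.prob (Q \<inter> (\<Union>j\<in>J. R j))"
      using meas un P.finite_measure_Diff' by blast
    moreover have "P.prob (Q \<inter> (\<Union>j\<in>J. R j)) \<le> P.prob (\<Union>j\<in>J. R j)"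
      using un by (intro P.finite_measure_mono) auto
    moreover have "P.prob (\<Union>j\<in>J. R j) \<le> (\<Sum>j\<in>J. P.prob (R j))"
      using J meas by (intro P.finite_measure_subadditive_finite) auto
    moreover have "\<dots> \<le> (\<Sum>j\<in>J. exp (- real N / real m ^ CARD('n)))"
      by (intro sum_mono R)
    ultimately show "1 - real m ^ CARD('n) * exp (- real N / real m ^ CARD('n))
        \<le> measure (sample_measure N) (Q - (\<Union>j\<in>J. R j))"
      using Q by (simp add: S J)
  qed
qed

text \<open>The grid has mesh \<open>1 / m\<close> with \<open>m\<close> the integer part of \<open>1 / s\<close> for the rate
  \<open>s = (ln (e N / \<delta>) / N) powr (1 / CARD('n))\<close>, so that \<open>m ^ CARD('n) \<le> N / ln (e N / \<delta>)\<close>.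
  For \<open>s > 1\<close> no grid is needed, since the radius then exceeds the diameter of the cube.\<close>

lemma sample_dense:
  fixes N :: nat
  assumes \<delta>: "0 < \<delta>" "\<delta> < 1" and N: "1 \<le> N"
  defines "s \<equiv> (ln (exp 1 * real N / \<delta>) / real N) powr (1 / real CARD('n::finite))"
  obtains E where "E \<in> sets (sample_measure N :: (nat \<Rightarrow> real^'n) measure)"
    "E \<subseteq> {1..N} \<rightarrow>\<^sub>E unit_cube" "1 - \<delta> \<le> measure (sample_measure N) E"
    "\<And>x z. x \<in> E \<Longrightarrow> z \<in> unit_cube \<Longrightarrow>
       \<exists>i\<in>{1..N}. norm (z - x i) \<le> 2 * sqrt (real CARD('n)) * s"
proof -
  define l where "l = ln (exp 1 * real N / \<delta>)"
  have "1 \<le> real N / \<delta>" using \<delta> N by (simp add: le_divide_eq)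
  \<comment> \<open>The factor \<open>exp 1\<close> inside the logarithm secures this. It makes
    \<open>s\<close> positive and gives \<open>real N / l \<le> real N\<close> below.\<close>
  then have l: "l \<ge> 1"
    using \<delta> N by (simp add: l_def ln_mult ln_div)
  have s: "s > 0" "s ^ CARD('n) = l / real N"
    using l N by (auto simp: s_def l_def[symmetric] simp flip: powr_realpow powr_powr)
      (simp add: powr_powr)
  show thesis
  proof (cases "s \<le> 1")
    case True
    define m where "m = nat \<lfloor>1 / s\<rfloor>"
    \<comment> \<open>As \<open>1 / s \<ge> 1\<close>, taking the floor loses at most a factor 2;
      this is the 2 in the radius.\<close>
    have m: "m > 0" "1 / real m \<le> 2 * s" "real m ^ CARD('n) \<le> real N / l"
    proof -
      have "1 / s \<ge> 1" using s True by simp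
      then have "1 \<le> \<lfloor>1 / s\<rfloor>" by (simp only: le_floor_iff of_int_1)
      moreover from this have "real m = of_int \<lfloor>1 / s\<rfloor>" unfolding m_def by linarith
      ultimately have *: "1 \<le> real m \<and> real m \<le> 1 / s \<and> 1 / s \<le> 2 * real m"
        by linarith
      then show "m > 0" "1 / real m \<le> 2 * s" using s by (auto simp: field_simps)
      have "real m ^ CARD('n) \<le> (1 / s) ^ CARD('n)" using * by (intro power_mono) auto
      then show "real m ^ CARD('n) \<le> real N / l" using s by (simp add: power_divide)
    qed
    obtain E where E: "E \<in> sets (sample_measure N :: (nat \<Rightarrow> real^'n) measure)"
      "E \<subseteq> {1..N} \<rightarrow>\<^sub>E unit_cube"
      "\<And>x j. x \<in> E \<Longrightarrow> j \<in> UNIV \<rightarrow>\<^sub>E {..<m} \<Longrightarrow> \<exists>i\<in>{1..N}. x i \<in> grid_cell m j"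
      "1 - real m ^ CARD('n) * exp (- real N / real m ^ CARD('n)) \<le> measure (sample_measure N) E"
      using sample_hits_all_cells[OF m(1)] by metis
    \<comment> \<open>There are at most \<open>N\<close> cells, and each is missed with probability
      at most \<open>exp (- l) = \<delta> / (exp 1 * N)\<close>.\<close>
    have "real m ^ CARD('n) * exp (- real N / real m ^ CARD('n)) \<le> real N * exp (- l)"
    proof (intro mult_mono)
      have "real N / l \<le> real N / 1" using l by (intro divide_left_mono) auto
      with m(3) show "real m ^ CARD('n) \<le> real N" by linarith
      have "l * real m ^ CARD('n) \<le> real N" using m(3) l by (simp add: field_simps)
      then show "exp (- real N / real m ^ CARD('n)) \<le> exp (- l)"
        using m(1) by (simp add: field_simps)
    qed auto
    also have "\<dots> = \<delta> / exp 1"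
      using \<delta> N by (simp add: l_def exp_minus)
    also have "\<dots> \<le> \<delta>" using \<delta> by (simp add: divide_le_eq)
    finally have "1 - \<delta> \<le> measure (sample_measure N) E" using E(4) by linarith
    moreover have "\<exists>i\<in>{1..N}. norm (z - x i) \<le> 2 * sqrt (real CARD('n)) * s"
      if x: "x \<in> E" and z: "z \<in> unit_cube" for x z
    proof -
      obtain j where j: "j \<in> UNIV \<rightarrow> {..<m}" "z \<in> grid_cell m j"
        using grid_cell_cover[OF m(1) z] by metis
      then have "j \<in> UNIV \<rightarrow>\<^sub>E {..<m}" by auto
      then obtain i where i: "i \<in> {1..N}" "x i \<in> grid_cell m j"
        using E(3)[OF x] by blast
      have "norm (z - x i) \<le> sqrt (real CARD('n)) * (1 / real m)"
        using grid_cell_diameter[OF j(2) i(2)] by simp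
      also have "\<dots> \<le> sqrt (real CARD('n)) * (2 * s)"
        using m(2) by (intro mult_left_mono) auto
      finally show ?thesis using i(1) by (auto simp: mult_ac)
    qed
    ultimately show thesis using that E by blast
  next
    case False
    have "\<exists>i\<in>{1..N}. norm (z - x i) \<le> 2 * sqrt (real CARD('n)) * s"
      if x: "x \<in> {1..N} \<rightarrow>\<^sub>E unit_cube" and z: "z \<in> unit_cube" for x and z :: "real^'n"
    proof (intro bexI)
      have "x 1 \<in> unit_cube" using x N by auto
      with z have "norm (z - x 1) \<le> sqrt (real CARD('n)) * 1"
        by (intro norm_le_sqrt_CARD) (simp add: mem_unit_cube_iff abs_le_iff, smt (verit))
      also have "\<dots> \<le> sqrt (real CARD('n)) * (2 * s)"
        using False by (intro mult_left_mono) auto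
      finally show "norm (z - x 1) \<le> 2 * sqrt (real CARD('n)) * s" by (simp add: mult_ac)
    qed (use N in auto)
    then show ?thesis
      using \<delta> that[OF sample_in_cube(1)] unfolding sample_in_cube(2) by simp
  qed
qed

section \<open>Near-optimal functions and their loss\<close>

lemma compact_unit_cube: "compact unit_cube"
  and convex_unit_cube: "convex unit_cube"
  by (simp_all add: unit_cube_def)

text \<open>\<open>frechet_derivative\<close> is a choice among derivatives. Uniqueness within a
  nondegenerate box, boundary points included, identifies it with any derivative at hand.\<close>

lemma gradient_on_unit_cube:
  assumes "(f has_derivative f') (at x within unit_cube)" "x \<in> unit_cube"
  shows "gradient_on unit_cube f x = (\<chi> i. f' (axis i 1))"
proof -
  have "frechet_derivative f (at x within cbox 0 1) = f'"
    using assms unfolding unit_cube_def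
    by (intro frechet_derivative_within_cbox) (auto simp: Basis_vec_def inner_axis)
  then show ?thesis by (simp add: gradient_on_def unit_cube_def)
qed

lemma has_derivative_gradient_on:
  assumes "f differentiable_on unit_cube" "x \<in> unit_cube"
  shows "(f has_derivative (\<lambda>v. gradient_on unit_cube f x \<bullet> v)) (at x within unit_cube)"
proof -
  obtain f' where f': "(f has_derivative f') (at x within unit_cube)"
    using assms by (auto simp: differentiable_on_def differentiable_def)
  have "f' v = gradient_on unit_cube f x \<bullet> v" for v
  proof -
    interpret f': linear f' using f' by (rule has_derivative_linear)
    have "f' v = f' (\<Sum>i\<in>UNIV. v $ i *\<^sub>R axis i 1)"
      by (simp add: basis_expansion flip: scalar_mult_eq_scaleR)
    also have "\<dots> = gradient_on unit_cube f x \<bullet> v"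
      by (simp add: gradient_on_unit_cube[OF f' assms(2)] f'.sum f'.scaleR inner_vec_def mult.commute)
    finally show ?thesis .
  qed
  then have "f' = (\<lambda>v. gradient_on unit_cube f x \<bullet> v)" by blast
  with f' show ?thesis by simp
qed

text \<open>Mollifying near the boundary averages over points outside the cube, so \<open>h\<close>
  is first extended by \<open>h \<circ> closest_point\<close>. This keeps the constant
  \<open>L\<close>, and agrees with \<open>h\<close> on the cube because the projection fixes its
  points.\<close>

lemma C1_approximation_unit_cube:
  fixes h :: "real^'n \<Rightarrow> real"
  assumes h: "L-lipschitz_on unit_cube h" and e: "e > 0"
  obtains \<phi> where "\<phi> \<in> C1_functions unit_cube" "L-lipschitz_on unit_cube \<phi>"
    "\<And>x. x \<in> unit_cube \<Longrightarrow> \<bar>\<phi> x - h x\<bar> \<le> e"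
proof -
  let ?D = "unit_cube :: (real^'n) set" let ?p = "closest_point ?D"
  have closed: "closed ?D" by (simp add: compact_imp_closed compact_unit_cube)
  have p: "1-lipschitz_on UNIV ?p"
    using closest_point_lipschitz[OF convex_unit_cube closed unit_cube_nonempty]
    by (intro lipschitz_onI) auto
  have p_in: "range ?p \<subseteq> ?D"
    using closest_point_in_set[OF closed unit_cube_nonempty] by auto
  have ext: "L-lipschitz_on UNIV (\<lambda>x. h (?p x))"
    using lipschitz_on_compose2[OF p lipschitz_on_subset[OF h p_in]] by simp
  obtain \<phi> \<phi>' where \<phi>: "continuous_on ?D \<phi>'"
    "\<And>x. x \<in> ?D \<Longrightarrow> (\<phi> has_derivative blinfun_apply (\<phi>' x)) (at x within ?D)"
    "L-lipschitz_on ?D \<phi>" "\<And>x. \<bar>\<phi> x - h (?p x)\<bar> \<le> e"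
    using C1_approximation[OF ext compact_unit_cube convex_unit_cube e] by metis
  show thesis
  proof (rule that)
    have "continuous_on ?D (\<lambda>x. \<chi> i. \<phi>' x (axis i 1))"
      by (intro continuous_intros \<phi>(1))
    then have "continuous_on ?D (gradient_on ?D \<phi>)"
      by (rule continuous_on_eq) (simp add: gradient_on_unit_cube[OF \<phi>(2)])
    then show "\<phi> \<in> C1_functions ?D"
      using \<phi>(2) by (auto simp: C1_functions_def differentiable_on_def differentiable_def)
    show "\<bar>\<phi> x - h x\<bar> \<le> e" if "x \<in> ?D" for x
      using \<phi>(4)[of x] that by (simp add: closest_point_self)
  qed (rule \<phi>(3))
qed

text \<open>A real supremum bounds its family only if the family is bounded above; here compactness
  and continuity ensure that.\<close>

lemma norm_le_sup_norm:
  assumes "compact D" "continuous_on D u" "x \<in> D"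
  shows "norm (u x) \<le> sup_norm D u"
proof -
  have "compact ((\<lambda>x. norm (u x)) ` D)"
    using assms by (intro compact_continuous_image continuous_intros)
  then show ?thesis
    unfolding sup_norm_def
    using assms(3) by (intro cSUP_upper bounded_imp_bdd_above compact_imp_bounded)
qed

text \<open>Half of \<eta> is spent on mollifying \<open>h\<close> to \<phi>, half on the element of
  \<open>L0\<close> near \<phi>. The gradient of \<open>f - \<phi>\<close> is then small, and the
  mean value inequality on the convex cube makes \<open>f - \<phi>\<close> \<eta>-Lipschitz; the
  constants add.\<close>

lemma C01_dense_approximation:
  fixes h :: "real^'n \<Rightarrow> real"
  assumes dense: "C01_dense unit_cube L0" and h: "L-lipschitz_on unit_cube h" and \<eta>: "\<eta> > 0"
  obtains f where "f \<in> L0" "(L + \<eta>)-lipschitz_on unit_cube f"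
    "\<And>x. x \<in> unit_cube \<Longrightarrow> \<bar>f x - h x\<bar> \<le> \<eta>"
proof -
  let ?D = "unit_cube :: (real^'n) set"
  obtain \<phi> where \<phi>: "\<phi> \<in> C1_functions ?D" "L-lipschitz_on ?D \<phi>"
    "\<And>x. x \<in> ?D \<Longrightarrow> \<bar>\<phi> x - h x\<bar> \<le> \<eta> / 2"
    using C1_approximation_unit_cube[OF h, of "\<eta> / 2"] \<eta> by auto
  let ?G = "\<lambda>f x. gradient_on ?D f x - gradient_on ?D \<phi> x"
  obtain f where f: "f \<in> L0" "f \<in> C1_functions ?D"
    "sup_norm ?D (\<lambda>x. f x - \<phi> x) + sup_norm ?D (?G f) \<le> \<eta> / 2"
  proof -
    have "\<eta> / 2 > 0" using \<eta> by simp
    then show thesis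
      using dense \<phi>(1) that unfolding C01_dense_def by blast
  qed
  have diff: "\<phi> differentiable_on ?D" "f differentiable_on ?D"
    and cont: "continuous_on ?D (gradient_on ?D \<phi>)" "continuous_on ?D (gradient_on ?D f)"
    using \<phi>(1) f(2) by (auto simp: C1_functions_def)
  have val: "\<bar>f x - \<phi> x\<bar> \<le> sup_norm ?D (\<lambda>x. f x - \<phi> x)" if "x \<in> ?D" for x
    using norm_le_sup_norm[OF compact_unit_cube, of "\<lambda>x. f x - \<phi> x" x] that diff
    by (simp add: continuous_on_diff differentiable_imp_continuous_on)
  have grad: "norm (?G f x) \<le> sup_norm ?D (?G f)" if "x \<in> ?D" for x
    using norm_le_sup_norm[OF compact_unit_cube, of "?G f" x] that cont
    by (simp add: continuous_on_diff)
  obtain x0 where x0: "x0 \<in> ?D" using unit_cube_nonempty by blast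
  \<comment> \<open>Nonnegativity of both norms lets the bound on their sum pass to each of
    them.\<close>
  have "0 \<le> sup_norm ?D (\<lambda>x. f x - \<phi> x)" "0 \<le> sup_norm ?D (?G f)"
    using val[OF x0] grad[OF x0] by (meson abs_ge_zero norm_ge_zero order_trans)+
  with f(3) have val': "\<bar>f x - \<phi> x\<bar> \<le> \<eta> / 2" and grad': "norm (?G f x) \<le> \<eta>"
    if "x \<in> ?D" for x
    using val[OF that] grad[OF that] \<eta> by linarith+
  have "\<eta>-lipschitz_on ?D (\<lambda>x. f x - \<phi> x)"
  proof (rule lipschitz_onI)
    fix x y assume xy: "x \<in> ?D" "y \<in> ?D"
    have "norm ((f x - \<phi> x) - (f y - \<phi> y)) \<le> \<eta> * norm (x - y)"
    proof (rule differentiable_bound[OF convex_unit_cube _ _ xy])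
      fix z assume z: "z \<in> ?D"
      show "((\<lambda>x. f x - \<phi> x) has_derivative (\<lambda>v. ?G f z \<bullet> v)) (at z within ?D)"
        using has_derivative_diff[OF has_derivative_gradient_on[OF diff(2) z]
            has_derivative_gradient_on[OF diff(1) z]]
        by (simp add: inner_diff_left)
      show "onorm (\<lambda>v. ?G f z \<bullet> v) \<le> \<eta>"
      proof (rule onorm_bound)
        fix v
        have "norm (?G f z \<bullet> v) \<le> norm (?G f z) * norm v"
          by (simp add: Cauchy_Schwarz_ineq2)
        also have "\<dots> \<le> \<eta> * norm v"
          by (intro mult_right_mono grad'[OF z]) simp
        finally show "norm (?G f z \<bullet> v) \<le> \<eta> * norm v" .
      qed (use \<eta> in simp)
    qed
    then show "dist (f x - \<phi> x) (f y - \<phi> y) \<le> \<eta> * dist x y" by (simp add: dist_norm)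
  qed (use \<eta> in simp)
  from lipschitz_on_add[OF \<phi>(2) this] have "(L + \<eta>)-lipschitz_on ?D f" by simp
  moreover have "\<bar>f x - h x\<bar> \<le> \<eta>" if "x \<in> ?D" for x
    using \<phi>(3)[OF that] val'[OF that] by linarith
  ultimately show thesis using f(1) that by blast
qed

section \<open>Feasibility and loss for a fixed sample\<close>

lemma training_loss_dataset_le_iff:
  assumes "1 \<le> N"
  shows "training_loss (dataset N x y) f \<le> \<epsilon> \<longleftrightarrow> (\<forall>i\<in>{1..N}. \<bar>y i - f (x i)\<bar> \<le> \<epsilon>)"
  using assms by (auto simp: training_loss_def dataset_def image_image)

lemma noisy_dataset_dataset_iff:
  "noisy_dataset D g \<epsilon> (dataset N x y) \<longleftrightarrow> (\<forall>i\<in>{1..N}. x i \<in> D \<and> \<bar>g (x i) - y i\<bar> \<le> \<epsilon>)"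
  by (auto simp: noisy_dataset_def dataset_def)

text \<open>An optimal \<open>fs\<close> usually meets the constraint with equality, which leaves no room for the
  approximation error. Mixing in a little of \<open>g\<close>, whose training error is at most
  \<open>\<epsilon>bar < \<epsilon>\<close>, creates slack at a small cost in the Lipschitz constant.\<close>

lemma feasible_approximation:
  assumes dense: "C01_dense unit_cube L0" and N: "1 \<le> N"
    and g: "g \<in> lipschitz_functions unit_cube"
    and noise: "noisy_dataset unit_cube g \<epsilon>bar (dataset N x y)" "\<epsilon>bar < \<epsilon>"
    and fs: "feasible unit_cube (dataset N x y) \<epsilon> fs" and \<rho>: "0 < \<rho>"
  shows "\<exists>f\<in>L0. feasible unit_cube (dataset N x y) \<epsilon> f \<and>
    Lip unit_cube f \<le> Lip unit_cube fs + ennreal \<rho>"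
proof -
  define l where "l = enn2real (Lip unit_cube fs)"
  define lg where "lg = enn2real (Lip unit_cube g)"
  have fs': "fs \<in> lipschitz_functions unit_cube"
    "\<And>i. i \<in> {1..N} \<Longrightarrow> \<bar>y i - fs (x i)\<bar> \<le> \<epsilon>"
    using fs N by (auto simp: feasible_def training_loss_dataset_le_iff)
  have x: "\<And>i. i \<in> {1..N} \<Longrightarrow> x i \<in> unit_cube"
    and g': "\<And>i. i \<in> {1..N} \<Longrightarrow> \<bar>g (x i) - y i\<bar> \<le> \<epsilon>bar"
    using noise(1) by (auto simp: noisy_dataset_dataset_iff)
  have nonneg: "0 \<le> l" "0 \<le> lg" by (simp_all add: l_def lg_def)
  \<comment> \<open>The weight of \<open>g\<close> in the mixture: at most 1 for convexity, and
    small enough that \<open>g\<close> adds at most \<open>\<rho> / 2\<close> to the Lipschitz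
    constant. The \<open>+ 1\<close> covers \<open>lg = 0\<close>.\<close>
  define t where "t = min 1 (\<rho> / (2 * (lg + 1)))"
  have t: "0 < t" "t \<le> 1" using \<rho> nonneg by (auto simp: t_def)
  have "t * lg \<le> \<rho> / (2 * (lg + 1)) * (lg + 1)"
    using \<rho> nonneg by (intro mult_mono) (auto simp: t_def)
  also have "\<dots> = \<rho> / 2" using nonneg by (simp add: field_simps)
  finally have tlg: "t * lg \<le> \<rho> / 2" .
  define h where "h z = (1 - t) * fs z + t * g z" for z
  have "((1 - t) * l + t * lg)-lipschitz_on unit_cube h"
    unfolding h_def l_def lg_def using t
    by (intro lipschitz_on_add lipschitz_on_cmult_real_nonneg lipschitz_on_Lip fs' g) auto
  moreover have "0 \<le> t * l" using t nonneg by simp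
  then have "(1 - t) * l + t * lg \<le> l + \<rho> / 2"
    using tlg unfolding left_diff_distrib by linarith
  ultimately have h_lip: "(l + \<rho> / 2)-lipschitz_on unit_cube h"
    by (rule lipschitz_on_le)
  have h_err: "\<bar>y i - h (x i)\<bar> \<le> \<epsilon> - t * (\<epsilon> - \<epsilon>bar)" if i: "i \<in> {1..N}" for i
  proof -
    have "y i - h (x i) = (1 - t) * (y i - fs (x i)) + t * (y i - g (x i))"
      by (simp add: h_def algebra_simps)
    also have "\<bar>\<dots>\<bar> \<le> (1 - t) * \<bar>y i - fs (x i)\<bar> + t * \<bar>y i - g (x i)\<bar>"
      using t by (intro order_trans[OF abs_triangle_ineq]) (simp add: abs_mult)
    also have "\<dots> \<le> (1 - t) * \<epsilon> + t * \<epsilon>bar"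
      using t fs'(2)[OF i] g'[OF i] by (intro add_mono mult_left_mono) (auto simp: abs_minus_commute)
    finally show ?thesis by (simp add: algebra_simps)
  qed
  \<comment> \<open>The approximation may use the remaining \<open>\<rho> / 2\<close> of the
    Lipschitz budget and the slack \<open>t * (\<epsilon> - \<epsilon>bar)\<close> gained in the
    constraint.\<close>
  define \<eta> where "\<eta> = min (\<rho> / 2) (t * (\<epsilon> - \<epsilon>bar))"
  have \<eta>: "0 < \<eta>" "\<eta> \<le> \<rho> / 2" "\<eta> \<le> t * (\<epsilon> - \<epsilon>bar)"
    using \<rho> t noise(2) by (auto simp: \<eta>_def)
  obtain f where f: "f \<in> L0" "(l + \<rho> / 2 + \<eta>)-lipschitz_on unit_cube f"
    "\<And>z. z \<in> unit_cube \<Longrightarrow> \<bar>f z - h z\<bar> \<le> \<eta>"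
    using C01_dense_approximation[OF dense h_lip \<eta>(1)] by metis
  have f_lip: "(l + \<rho>)-lipschitz_on unit_cube f"
    using f(2) by (rule lipschitz_on_le) (use \<eta> in simp)
  have "Lip unit_cube f \<le> ennreal (l + \<rho>)"
    using f_lip nonneg \<rho> by (simp add: Lip_le_ennreal_iff del: ennreal_plus)
  also have "\<dots> = Lip unit_cube fs + ennreal \<rho>"
    using fs'(1) nonneg \<rho> by (simp add: l_def lipschitz_functions_def)
  finally have "Lip unit_cube f \<le> Lip unit_cube fs + ennreal \<rho>" .
  moreover have "\<bar>y i - f (x i)\<bar> \<le> \<epsilon>" if i: "i \<in> {1..N}" for i
    using h_err[OF i] f(3)[OF x[OF i]] \<eta>(3) by linarith
  ultimately show ?thesis
    using f(1) f_lip N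
    by (auto simp: feasible_def training_loss_dataset_le_iff lipschitz_functions_iff)
qed

text \<open>Triangle inequality along \<open>g z\<close>, \<open>g (x i)\<close>,
  \<open>y i\<close>, \<open>f (x i)\<close>, \<open>f z\<close>: the outer steps cost the Lipschitz
  constants times \<open>r\<close>, the two inner ones \<epsilon> each.\<close>

lemma loss_le_of_dense_sample:
  assumes N: "1 \<le> N" and noise: "noisy_dataset D g \<epsilon> (dataset N x y)"
    and g: "lg-lipschitz_on D g" and f: "lf-lipschitz_on D f"
    and loss: "training_loss (dataset N x y) f \<le> \<epsilon>"
    and dense: "\<And>z. z \<in> D \<Longrightarrow> \<exists>i\<in>{1..N}. norm (z - x i) \<le> r" and D: "D \<noteq> {}"
  shows "loss D f g \<le> (lg + lf) * r + 2 * \<epsilon>"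
  unfolding loss_def
proof (rule cSUP_least[OF D])
  fix z assume z: "z \<in> D"
  obtain i where i: "i \<in> {1..N}" "norm (z - x i) \<le> r" using dense[OF z] by blast
  have xi: "x i \<in> D" "\<bar>g (x i) - y i\<bar> \<le> \<epsilon>" "\<bar>y i - f (x i)\<bar> \<le> \<epsilon>"
    using noise loss i(1) N by (auto simp: noisy_dataset_dataset_iff training_loss_dataset_le_iff)
  have "\<bar>g z - g (x i)\<bar> \<le> lg * norm (z - x i)" "\<bar>f z - f (x i)\<bar> \<le> lf * norm (z - x i)"
    using lipschitz_on_normD[OF g z xi(1)] lipschitz_on_normD[OF f z xi(1)] by simp_all
  moreover have "lg * norm (z - x i) + lf * norm (z - x i) \<le> (lg + lf) * r"
    unfolding distrib_right[symmetric]
    using i(2) lipschitz_on_nonneg[OF g] lipschitz_on_nonneg[OF f] by (intro mult_left_mono) auto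
  ultimately show "\<bar>g z - f z\<bar> \<le> (lg + lf) * r + 2 * \<epsilon>"
    using xi(2,3) by linarith
qed

theorem theorem3:
  shows "\<exists>k1::real. \<exists>k2::real. \<exists>N0::nat. k1 > 0 \<and> k2 > 0 \<and>
    (\<forall>(L0 :: (real^'n \<Rightarrow> real) set) (g :: real^'n \<Rightarrow> real) (\<epsilon>bar::real) (\<delta>::real) (\<rho>::real)
       (\<epsilon>::real) (N::nat)
       (y :: (nat \<Rightarrow> real^'n) \<Rightarrow> nat \<Rightarrow> real) (fstar :: (nat \<Rightarrow> real^'n) \<Rightarrow> real^'n \<Rightarrow> real).
       C01_dense unit_cube L0 \<longrightarrow>
       g \<in> lipschitz_functions unit_cube \<longrightarrow>
       0 \<le> \<epsilon>bar \<longrightarrow> 0 < \<delta> \<longrightarrow> \<delta> < 1 \<longrightarrow> 0 < \<rho> \<longrightarrow> \<epsilon>bar < \<epsilon> \<longrightarrow> N0 \<le> N \<longrightarrow>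
       (\<forall>x \<in> {1..N} \<rightarrow>\<^sub>E unit_cube. noisy_dataset unit_cube g \<epsilon>bar (dataset N x (y x))) \<longrightarrow>
       (\<forall>x \<in> {1..N} \<rightarrow>\<^sub>E unit_cube. solution unit_cube (dataset N x (y x)) \<epsilon> (fstar x)) \<longrightarrow>
       (\<forall>x \<in> {1..N} \<rightarrow>\<^sub>E unit_cube. \<exists>f\<in>L0.
          feasible unit_cube (dataset N x (y x)) \<epsilon> f \<and>
          Lip unit_cube f \<le> Lip unit_cube (fstar x) + ennreal \<rho>) \<and>
       (\<forall>f :: (nat \<Rightarrow> real^'n) \<Rightarrow> real^'n \<Rightarrow> real.
          (\<forall>x \<in> {1..N} \<rightarrow>\<^sub>E unit_cube.
             f x \<in> L0 \<and> feasible unit_cube (dataset N x (y x)) \<epsilon> (f x) \<and>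
             Lip unit_cube (f x) \<le> Lip unit_cube (fstar x) + ennreal \<rho>) \<longrightarrow>
          inner_prob (sample_measure N)
            {x \<in> {1..N} \<rightarrow>\<^sub>E unit_cube.
               loss unit_cube (f x) g
               \<le> (2 * enn2real (Lip unit_cube g) + \<rho>) * k1
                   * (ln (k2 * real N / \<delta>) / real N) powr (1 / real CARD('n))
                 + 2 * \<epsilon>}
          \<ge> 1 - \<delta>))"
\<comment> \<open>The witnesses are read off \<open>sample_dense\<close>: \<open>k1\<close> is the
  factor of the radius, \<open>k2\<close> the factor inside the logarithm, and \<open>N0 = 1\<close>
  provides a sample point.\<close>
proof (rule exI[of _ "2 * sqrt (real CARD('n))"], rule exI[of _ "exp 1"], rule exI[of _ 1],
    intro conjI allI impI, goal_cases)
  case (3 L0 g \<epsilon>bar \<delta> \<rho> \<epsilon> N y fstar)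
  then show ?case
    by (auto simp: solution_def intro!: feasible_approximation)
next
  case (4 L0 g \<epsilon>bar \<delta> \<rho> \<epsilon> N y fstar f)
  define lg where "lg = enn2real (Lip unit_cube g)"
  define s where "s = (ln (exp 1 * real N / \<delta>) / real N) powr (1 / real CARD('n))"
  note g = \<open>g \<in> lipschitz_functions unit_cube\<close>
  have lg: "0 \<le> lg" "ennreal lg = Lip unit_cube g" "lg-lipschitz_on unit_cube g"
    using g lipschitz_on_Lip[OF g] by (auto simp: lg_def lipschitz_functions_def)
  \<comment> \<open>\<open>E\<close> depends only on the sample points, so on it the bound holds for
    every admissible choice of \<open>f\<close>, however \<open>y\<close> and \<open>f\<close>
    depend on the sample.\<close>
  obtain E where E: "E \<in> sets (sample_measure N :: (nat \<Rightarrow> real^'n) measure)"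
    "E \<subseteq> {1..N} \<rightarrow>\<^sub>E unit_cube" "1 - \<delta> \<le> measure (sample_measure N) E"
    "\<And>x z. x \<in> E \<Longrightarrow> z \<in> unit_cube \<Longrightarrow>
       \<exists>i\<in>{1..N}. norm (z - x i) \<le> 2 * sqrt (real CARD('n)) * s"
    using sample_dense[where 'n='n, OF \<open>0 < \<delta>\<close> \<open>\<delta> < 1\<close> \<open>1 \<le> N\<close>] unfolding s_def by metis
  have "prob_space (sample_measure N :: (nat \<Rightarrow> real^'n) measure)"
    unfolding sample_measure_def by (intro prob_space_PiM unit_cube_prob_space)
  then show ?case
  proof (rule inner_prob_ge[OF _ E(1) _ E(3)], intro subsetI CollectI conjI)
    fix x assume x: "x \<in> E"
    show xc: "x \<in> {1..N} \<rightarrow>\<^sub>E unit_cube" using x E(2) by blast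
    \<comment> \<open>Relaxing the noise level from \<open>\<epsilon>bar\<close> to \<epsilon> makes
      \<open>g\<close> a competitor of \<open>fstar x\<close>; it also produces the term
      \<open>2 * \<epsilon>\<close>.\<close>
    have noise: "noisy_dataset unit_cube g \<epsilon> (dataset N x (y x))"
      using 4 xc by (fastforce simp: noisy_dataset_dataset_iff)
    have "feasible unit_cube (dataset N x (y x)) \<epsilon> g"
      using noise g \<open>1 \<le> N\<close>
      by (auto simp: feasible_def training_loss_dataset_le_iff noisy_dataset_dataset_iff abs_minus_commute)
    then have "Lip unit_cube (fstar x) \<le> Lip unit_cube g"
      using 4 xc by (auto simp: solution_def)
    then have "Lip unit_cube (f x) \<le> ennreal lg + ennreal \<rho>"
      using 4 xc lg(2) by (metis add_right_mono order_trans)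
    then have f_lip: "(lg + \<rho>)-lipschitz_on unit_cube (f x)"
      using lg(1) \<open>0 < \<rho>\<close> by (simp add: Lip_le_ennreal_iff flip: ennreal_plus)
    have "loss unit_cube (f x) g \<le> (lg + (lg + \<rho>)) * (2 * sqrt (real CARD('n)) * s) + 2 * \<epsilon>"
      using 4 xc E(4)[OF x]
      by (intro loss_le_of_dense_sample[OF \<open>1 \<le> N\<close> noise lg(3) f_lip])
        (auto simp: feasible_def unit_cube_nonempty)
    then show "loss unit_cube (f x) g \<le> (2 * enn2real (Lip unit_cube g) + \<rho>)
        * (2 * sqrt (real CARD('n)))
        * (ln (exp 1 * real N / \<delta>) / real N) powr (1 / real CARD('n)) + 2 * \<epsilon>"
      by (simp add: lg_def s_def mult_ac)
  qed
qed auto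

end
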